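(* Let $x\in\mathbb{R}^n$ be a block $K$-sparse signal, $A\in\mathbb{R}^{m\times n}$, and $y=Ax+e$ with $e\in\mathbb{R}^m$. Suppose $\|e\|_2\le\varepsilon$ and the sensing matrix $A$ satisfies the block-RIP of order $NK+1$ with block-RIC $$\delta_{NK+1}<\frac{1}{\sqrt{\frac{K}{N}+1}}.$$ Then the BOMMP algorithm with the stopping rule $\|r^k\|_2\le\varepsilon$ recovers exactly the correct (block) support of $x$ if all the nonzero blocks $x[i]$ satisfy $$\|x[i]\|_2>\max\left\{\frac{\dfrac{\sqrt{2K(1+\delta_{NK+1})}\,\varepsilon}{\sqrt{\frac{K}{N}+1}}}{\dfrac{1}{\sqrt{\frac{K}{N}+1}}-\delta_{NK+1}},\ \frac{2\varepsilon}{\sqrt{1-\delta_{NK+1}}}\right\}.$$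
   Context: Block structure. Fix positive integers $d_1,\dots,d_l$ with $n=\sum_{i=1}^l d_i$ and write $\mathcal{I}=\{d_1,\dots,d_l\}$. A vector $x\in\mathbb{R}^n$ is viewed as a concatenation of consecutive blocks $x[1],\dots,x[l]$ with $x[i]\in\mathbb{R}^{d_i}$; a matrix $A\in\mathbb{R}^{m\times n}$ is correspondingly a concatenation of column blocks $A[1],\dots,A[l]$ with $A[i]\in\mathbb{R}^{m\times d_i}$. The block support of $x$ is $T=\text{block-supp}(x)=\{i:\|x[i]\|_2>0\}$, and $x$ is block $K$-sparse if $|T|\le K$. For $\Gamma\subseteq\{1,\dots,l\}$, $A_\Gamma$ is the submatrix of $A$ formed by the column blocks $A[i]$, $i\in\Gamma$. The prime denotes transpose. Block-RIP. $A$ satisfies the block-RIP of order $K$ if there is $\delta\in[0,1)$ with $(1-\delta)\|x\|_2^2\le\|Ax\|_2^2\le(1+\delta)\|x\|_2^2$ for all block $K$-sparse $x$ over $\mathcal{I}$; the smallest such $\delta$ is the block restricted isometry constant (block-RIC) $\delta_K=\delta_{K|\mathcal{I}}$. BOMMP (block orthogonal multi-matching pursuit) algorithm. Input: $y\in\mathbb{R}^m$, $A\in\mathbb{R}^{m\times n}$, block sparsity level $K$, number $N\ge 1$ of indices per selection ($N\le K$ and $N\le m/K$); $\epsilon$ denotes the stopping tolerance (here $\epsilon=\varepsilon$). Initialize $k=0$, $r^0=y$, $\Lambda^0=\varnothing$. While $\|r^k\|_2>\epsilon$ and $k<\min\{K,\frac{m}{K}\}$, set $k=k+1$ and perform: (identification)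 select the set $T^k$ of $N$ block indices corresponding to the $N$ largest values of $\|A'[i]r^{k-1}\|_2$, $i=1,\dots,l$, where $A'[i]=(A[i])'$; (augmentation) $\Lambda^k=\Lambda^{k-1}\cup T^k$; (estimation) $\hat{x}_{\Lambda^k}=\arg\min_u\|y-A_{\Lambda^k}u\|_2$; (residual update) $r^k=y-A_{\Lambda^k}\hat{x}_{\Lambda^k}$. Output: $\hat{x}=\arg\min_{u:\,\text{block-supp}(u)=\Lambda^k}\|y-Au\|_2$.
   Formalization: The cap k<min{K,m/K} is dropped (k≤|T| is proved); exact recovery means stopping exactly when Λ^k first contains the support, the output's support lying between it and Λ^k, with output support equal to it if N=1 or ε=0; the output minimizes over block-supp(u)⊆Λ^k. *)

theory Defs
  imports "HOL-Analysis.Analysis"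
begin

text \<open>
  Coordinates of \<open>\<real>\<^sup>n\<close> are indexed by a linearly ordered finite type with \<open>n\<close> elements; the
  blocks are numbered \<open>1, \<dots>, l\<close> and block \<open>i\<close> has \<open>d i\<close> coordinates. The coordinate \<open>p\<close> has
  (0-based) position \<open>card {q. q < p}\<close>.
\<close>

definition block :: "(nat \<Rightarrow> nat) \<Rightarrow> nat \<Rightarrow> 'n::{finite,linorder} set" where
  "block d i = {p. (\<Sum>j=1..<i. d j) \<le> card {q. q < p} \<and> card {q. q < p} < (\<Sum>j=1..i. d j)}"

definition block_norm :: "(nat \<Rightarrow> nat) \<Rightarrow> real^'n::{finite,linorder} \<Rightarrow> nat \<Rightarrow> real" where
  "block_norm d x i = L2_set (\<lambda>p. x $ p) (block d i)"

definition block_supp :: "(nat \<Rightarrow> nat) \<Rightarrow> nat \<Rightarrow> real^'n::{finite,linorder} \<Rightarrow> nat set" where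
  "block_supp d l x = {i \<in> {1..l}. block_norm d x i > 0}"

definition block_sparse :: "(nat \<Rightarrow> nat) \<Rightarrow> nat \<Rightarrow> nat \<Rightarrow> real^'n::{finite,linorder} \<Rightarrow> bool" where
  "block_sparse d l K x \<longleftrightarrow> card (block_supp d l x) \<le> K"

definition block_RIP_bound ::
    "real^'n::{finite,linorder}^'m \<Rightarrow> (nat \<Rightarrow> nat) \<Rightarrow> nat \<Rightarrow> nat \<Rightarrow> real \<Rightarrow> bool" where
  "block_RIP_bound A d l K \<delta> \<longleftrightarrow> 0 \<le> \<delta> \<and> \<delta> < 1 \<and>
     (\<forall>x. block_sparse d l K x \<longrightarrow>
        (1 - \<delta>) * (norm x)\<^sup>2 \<le> (norm (A *v x))\<^sup>2 \<and> (norm (A *v x))\<^sup>2 \<le> (1 + \<delta>) * (norm x)\<^sup>2)"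

definition block_RIP ::
    "real^'n::{finite,linorder}^'m \<Rightarrow> (nat \<Rightarrow> nat) \<Rightarrow> nat \<Rightarrow> nat \<Rightarrow> bool" where
  "block_RIP A d l K \<longleftrightarrow> (\<exists>\<delta>. block_RIP_bound A d l K \<delta>)"

definition block_RIC ::
    "real^'n::{finite,linorder}^'m \<Rightarrow> (nat \<Rightarrow> nat) \<Rightarrow> nat \<Rightarrow> nat \<Rightarrow> real" where
  "block_RIC A d l K = (LEAST \<delta>. block_RIP_bound A d l K \<delta>)"

text \<open>
  \<open>S\<close> consists of \<open>N\<close> indices carrying the \<open>N\<close> largest values of \<open>v\<close>; ties may be broken in any
  way, and all indices are taken if there are fewer than \<open>N\<close>.
\<close>

definition largest_indices :: "nat \<Rightarrow> nat \<Rightarrow> (nat \<Rightarrow> real) \<Rightarrow> nat set \<Rightarrow> bool" where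
  "largest_indices l N v S \<longleftrightarrow>
     S \<subseteq> {1..l} \<and> card S = min N l \<and> (\<forall>i\<in>S. \<forall>j\<in>{1..l} - S. v j \<le> v i)"

text \<open>
  A vector indexed by the blocks in \<open>\<Lambda>\<close> is represented by its extension by zero to \<open>\<real>\<^sup>n\<close>, so that
  the product of the submatrix with it is the product of the full matrix with the extension.
\<close>

definition least_squares ::
    "real^'n::{finite,linorder}^'m \<Rightarrow> (nat \<Rightarrow> nat) \<Rightarrow> nat \<Rightarrow> real^'m \<Rightarrow> nat set \<Rightarrow>
     real^'n::{finite,linorder} \<Rightarrow> bool" where
  "least_squares A d l y \<Lambda> u \<longleftrightarrow>
     is_arg_min (\<lambda>u. norm (y - A *v u)) (\<lambda>u. block_supp d l u \<subseteq> \<Lambda>) u"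

text \<open>
  \<open>\<Lambda> k\<close>, \<open>u k\<close> and \<open>r k\<close> are the index set, the estimate and the residual after \<open>k\<close> passes through
  the loop with the stopping rule \<open>norm (r k) \<le> \<epsilon>\<close>. Passes are performed only as long as the
  stopping rule has not been met; later entries of the sequences are unconstrained. If the loop
  stops after \<open>k\<close> passes, the output is \<open>u k\<close>.
\<close>

definition bommp_run ::
    "real^'n::{finite,linorder}^'m \<Rightarrow> (nat \<Rightarrow> nat) \<Rightarrow> nat \<Rightarrow> nat \<Rightarrow> real \<Rightarrow> real^'m \<Rightarrow>
     (nat \<Rightarrow> nat set) \<Rightarrow> (nat \<Rightarrow> real^'n::{finite,linorder}) \<Rightarrow> (nat \<Rightarrow> real^'m) \<Rightarrow> bool" where
  "bommp_run A d l N \<epsilon> y \<Lambda> u r \<longleftrightarrow>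
     \<Lambda> 0 = {} \<and> u 0 = 0 \<and> r 0 = y \<and>
     (\<forall>k. (\<forall>j\<le>k. norm (r j) > \<epsilon>) \<longrightarrow>
        (\<exists>S. largest_indices l N (block_norm d (transpose A *v r k)) S \<and> \<Lambda> (Suc k) = \<Lambda> k \<union> S) \<and>
        least_squares A d l y (\<Lambda> (Suc k)) (u (Suc k)) \<and>
        r (Suc k) = y - A *v u (Suc k))"

end

theory Submission
  imports Defs
begin

text \<open>
  Let \<open>T\<close> be the block support of \<open>x\<close>. As long as \<open>T\<close> is not covered by \<open>\<Lambda>\<close>, put \<open>w = x - u\<close>,
  \<open>r = A w + e\<close> and \<open>h = A' r\<close>, so that \<open>h\<close> vanishes on \<open>\<Lambda>\<close>. If the \<open>N\<close> selected blocks \<open>S\<close> missed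
  \<open>T - \<Lambda>\<close>, then comparing block norms gives \<open>\<sigma> \<langle>h, w\<rangle> \<le> \<parallel>h[S]\<parallel> \<parallel>w\<parallel>\<close> with \<open>\<sigma> = \<surd>(N/K)\<close>.
  Rescaling \<open>h[S]\<close> to a vector \<open>z\<close> of norm \<open>\<parallel>w\<parallel>\<close>, which is orthogonal to \<open>w\<close>, and putting
  \<open>q = z - \<sigma> w\<close>, this reads \<open>0 \<le> \<langle>A w + e, A q\<rangle>\<close>. The polarized RIP bounds the right-hand side by
  \<open>\<parallel>w\<parallel> (\<parallel>w\<parallel> (\<delta> \<surd>(1 + \<sigma>\<^sup>2) - \<sigma>) + \<epsilon> \<surd>(1 + \<delta>) \<surd>(1 + \<sigma>\<^sup>2))\<close>, which is negative because \<open>\<parallel>w\<parallel>\<close> is at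
  least the norm of an uncovered block of \<open>x\<close>. So every pass finds a new index of \<open>T\<close>, and the
  index sets occurring have at most \<open>N K + 1\<close> elements.
\<close>

section \<open>Blocks as a partition of the coordinates\<close>

lemma block_disjoint: "i \<noteq> j \<Longrightarrow> block d i \<inter> block d j = {}"
proof (induction i j rule: linorder_wlog)
  case (le i j)
  then have "{1..i} \<subseteq> {1..<j}" by auto
  then have "(\<Sum>k=1..i. d k) \<le> (\<Sum>k=1..<j. d k)" by (intro sum_mono2) auto
  then show ?case unfolding block_def by auto
next
  case (sym i j)
  then show ?case by auto
qed

text \<open>The block of a coordinate is the least index whose cumulative size exceeds its position.
  Such an index exists because \<open>{q. q < p}\<close> omits \<open>p\<close>, so the position is
  below \<open>CARD('n)\<close>.\<close>

lemma Union_block: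
  assumes "(\<Sum>i=1..l. d i) = CARD('n::{finite,linorder})"
  shows "(\<Union>i\<in>{1..l}. block d i) = (UNIV :: 'n set)"
proof (intro set_eqI iffI UNIV_I)
  fix p :: 'n
  have lt: "card {q. q < p} < (\<Sum>i=1..l. d i)"
    unfolding assms by (rule psubset_card_mono) auto
  define i where "i = (LEAST i. card {q. q < p} < (\<Sum>j=1..i. d j))"
  have i: "card {q. q < p} < (\<Sum>j=1..i. d j)"
    unfolding i_def using lt by (rule LeastI)
  have "i \<le> l" unfolding i_def using lt by (rule Least_le)
  have "i \<noteq> 0" using i by (intro notI) simp
  then have "\<not> card {q. q < p} < (\<Sum>j=1..i - 1. d j)"
    unfolding i_def by (intro not_less_Least) simp
  moreover have "{1..i - 1} = {1..<i}" using \<open>i \<noteq> 0\<close> by auto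
  ultimately have "p \<in> block d i" using i by (simp add: block_def)
  then show "p \<in> (\<Union>i\<in>{1..l}. block d i)" using \<open>i \<le> l\<close> \<open>i \<noteq> 0\<close> by auto
qed

lemma sum_blocks:
  assumes "(\<Sum>i=1..l. d i) = CARD('n::{finite,linorder})"
  shows "(\<Sum>p\<in>UNIV. f p) = (\<Sum>i=1..l. \<Sum>p\<in>block d i. f (p::'n))"
  unfolding Union_block[OF assms, symmetric]
  by (rule sum.UNION_disjoint) (auto dest: block_disjoint)

lemma inner_blocks:
  fixes v w :: "real^'n::{finite,linorder}"
  assumes "(\<Sum>i=1..l. d i) = CARD('n)"
  shows "v \<bullet> w = (\<Sum>i=1..l. \<Sum>p\<in>block d i. v $ p * w $ p)"
  unfolding inner_vec_def inner_real_def by (rule sum_blocks[OF assms])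

lemma block_norm_nonneg: "0 \<le> block_norm d x i"
  by (simp add: block_norm_def)

lemma block_norm_power2: "(block_norm d x i)\<^sup>2 = (\<Sum>p\<in>block d i. x $ p * x $ p)"
  by (simp add: block_norm_def L2_set_def sum_nonneg power2_eq_square)

lemma block_norm_eq_0_iff: "block_norm d x i = 0 \<longleftrightarrow> (\<forall>p\<in>block d i. x $ p = 0)"
  by (simp add: block_norm_def L2_set_eq_0_iff)

lemma block_inner_le:
  "(\<Sum>p\<in>block d i. v $ p * w $ p) \<le> block_norm d v i * block_norm d w i"
proof -
  have "(\<Sum>p\<in>block d i. v $ p * w $ p) \<le> (\<Sum>p\<in>block d i. \<bar>v $ p\<bar> * \<bar>w $ p\<bar>)"
    by (intro sum_mono) (metis abs_ge_self abs_mult)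
  also have "\<dots> \<le> block_norm d v i * block_norm d w i"
    unfolding block_norm_def by (rule L2_set_mult_ineq)
  finally show ?thesis .
qed

lemma norm_power2_blocks:
  fixes x :: "real^'n::{finite,linorder}"
  assumes "(\<Sum>i=1..l. d i) = CARD('n)"
  shows "(norm x)\<^sup>2 = (\<Sum>i=1..l. (block_norm d x i)\<^sup>2)"
  unfolding power2_norm_eq_inner inner_blocks[OF assms] block_norm_power2 ..

lemma block_norm_le_norm: "block_norm d x i \<le> norm x"
  unfolding block_norm_def norm_vec_def L2_set_def real_norm_def
  by (intro real_sqrt_le_mono order.trans[OF _ sum_mono2[OF _ subset_UNIV]]) auto

text \<open>Replaces the nonlinear block norms by vanishing of coordinates, a linear condition.
  Closure of the supports under linear combinations is then immediate.\<close>

lemma block_supp_subset_iff: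
  "block_supp d l x \<subseteq> \<Gamma> \<longleftrightarrow> (\<forall>i\<in>{1..l} - \<Gamma>. \<forall>p\<in>block d i. x $ p = 0)"
  unfolding block_supp_def less_le block_norm_eq_0_iff[symmetric]
  by (auto simp: block_norm_nonneg)

lemma block_supp_eq_empty_iff:
  fixes x :: "real^'n::{finite,linorder}"
  assumes "(\<Sum>i=1..l. d i) = CARD('n)"
  shows "block_supp d l x = {} \<longleftrightarrow> x = 0"
proof
  assume "block_supp d l x = {}"
  then have "block_norm d x i = 0" if "i \<in> {1..l}" for i
    using that block_norm_nonneg[of d x i] by (fastforce simp: block_supp_def)
  then have "(norm x)\<^sup>2 = 0" unfolding norm_power2_blocks[OF assms] by simp
  then show "x = 0" by simp
qed (simp add: block_supp_def block_norm_def L2_set_def)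

lemma finite_block_supp [simp]: "finite (block_supp d l x)"
  by (simp add: block_supp_def)

lemma block_sparseI:
  assumes "block_supp d l x \<subseteq> \<Gamma>" "finite \<Gamma>" "card \<Gamma> \<le> s"
  shows "block_sparse d l s x"
  unfolding block_sparse_def using card_mono[OF assms(2,1)] assms(3) by linarith

lemma block_supp_lincomb:
  assumes "block_supp d l v \<subseteq> \<Gamma>" "block_supp d l w \<subseteq> \<Gamma>"
  shows "block_supp d l (a *\<^sub>R v + b *\<^sub>R w) \<subseteq> \<Gamma>"
  using assms unfolding block_supp_subset_iff by simp

lemma block_supp_add:
  assumes "block_supp d l v \<subseteq> \<Gamma>" "block_supp d l w \<subseteq> \<Gamma>"
  shows "block_supp d l (v + w) \<subseteq> \<Gamma>"
  using block_supp_lincomb[OF assms, of 1 1] by simp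

lemma block_supp_diff:
  assumes "block_supp d l v \<subseteq> \<Gamma>" "block_supp d l w \<subseteq> \<Gamma>"
  shows "block_supp d l (v - w) \<subseteq> \<Gamma>"
  using block_supp_lincomb[OF assms, of 1 "-1"] by simp

lemma block_supp_scaleR:
  assumes "block_supp d l v \<subseteq> \<Gamma>"
  shows "block_supp d l (a *\<^sub>R v) \<subseteq> \<Gamma>"
  using block_supp_lincomb[OF assms assms, of a 0] by simp

section \<open>Restriction to a set of blocks\<close>

text \<open>A restriction stays in the full space, extended by zero, so \<open>A\<close> applies to
  it directly and it is an admissible vector for \<open>least_squares\<close>.\<close>

definition block_restrict ::
    "(nat \<Rightarrow> nat) \<Rightarrow> nat set \<Rightarrow> real^'n::{finite,linorder} \<Rightarrow> real^'n::{finite,linorder}" where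
  "block_restrict d \<Gamma> v = (\<chi> p. if \<exists>i\<in>\<Gamma>. p \<in> block d i then v $ p else 0)"

lemma block_restrict_nth:
  assumes "p \<in> block d i"
  shows "block_restrict d \<Gamma> v $ p = (if i \<in> \<Gamma> then v $ p else 0)"
proof -
  have "(\<exists>j\<in>\<Gamma>. p \<in> block d j) \<longleftrightarrow> i \<in> \<Gamma>"
    using assms block_disjoint by (metis disjoint_iff)
  then show ?thesis by (simp add: block_restrict_def)
qed

lemma block_supp_restrict: "block_supp d l (block_restrict d \<Gamma> v) \<subseteq> \<Gamma>"
  unfolding block_supp_subset_iff by (auto simp: block_restrict_nth)

lemma inner_block_restrict:
  fixes v w :: "real^'n::{finite,linorder}"
  assumes "(\<Sum>i=1..l. d i) = CARD('n)" and "\<Gamma> \<subseteq> {1..l}"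
  shows "v \<bullet> block_restrict d \<Gamma> w = (\<Sum>i\<in>\<Gamma>. \<Sum>p\<in>block d i. v $ p * w $ p)"
proof -
  have "v \<bullet> block_restrict d \<Gamma> w = (\<Sum>i\<in>\<Gamma>. \<Sum>p\<in>block d i. v $ p * block_restrict d \<Gamma> w $ p)"
    unfolding inner_blocks[OF assms(1)] using assms(2)
    by (intro sum.mono_neutral_right) (auto simp: block_restrict_nth)
  also have "\<dots> = (\<Sum>i\<in>\<Gamma>. \<Sum>p\<in>block d i. v $ p * w $ p)"
    by (auto simp: block_restrict_nth intro!: sum.cong)
  finally show ?thesis .
qed

lemma norm_block_restrict_power2:
  fixes v :: "real^'n::{finite,linorder}"
  assumes "(\<Sum>i=1..l. d i) = CARD('n)" and "\<Gamma> \<subseteq> {1..l}"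
  shows "(norm (block_restrict d \<Gamma> v))\<^sup>2 = (\<Sum>i\<in>\<Gamma>. (block_norm d v i)\<^sup>2)"
  unfolding power2_norm_eq_inner inner_block_restrict[OF assms] block_norm_power2
  by (auto simp: block_restrict_nth intro!: sum.cong)

lemma inner_transpose_matrix_vector:
  fixes A :: "real^'n^'m"
  shows "(transpose A *v r) \<bullet> v = r \<bullet> (A *v v)"
  by (simp add: transpose_matrix_vector dot_lmul_matrix)

section \<open>The restricted isometry constant and its consequences\<close>

text \<open>The \<open>LEAST\<close> is meaningful only if the infimum of the admissible constants
  is attained. For each sparse \<open>x \<noteq> 0\<close> the condition reads
  \<open>max (1 - c) (c - 1) \<le> \<delta>\<close> with \<open>c\<close> the ratio of squared
  norms, and such lower bounds pass to the infimum. Strictness of \<open>Inf D < 1\<close> is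
  inherited from any admissible constant.\<close>

lemma block_RIP_bound_block_RIC:
  assumes "block_RIP A d l s"
  shows "block_RIP_bound A d l s (block_RIC A d l s)"
proof -
  define D where "D = {\<delta>. block_RIP_bound A d l s \<delta>}"
  obtain \<delta>0 where \<delta>0: "\<delta>0 \<in> D" using assms by (auto simp: block_RIP_def D_def)
  have bdd: "bdd_below D"
    by (rule bdd_belowI[of _ 0]) (auto simp: D_def block_RIP_bound_def)
  have "(1 - Inf D) * (norm x)\<^sup>2 \<le> (norm (A *v x))\<^sup>2 \<and> (norm (A *v x))\<^sup>2 \<le> (1 + Inf D) * (norm x)\<^sup>2"
    if x: "block_sparse d l s x" for x
  proof (cases "x = 0")
    case False
    define c where "c = (norm (A *v x))\<^sup>2 / (norm x)\<^sup>2"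
    have "max (1 - c) (c - 1) \<le> Inf D"
    proof (rule cInf_greatest)
      show "D \<noteq> {}" using \<delta>0 by auto
      show "max (1 - c) (c - 1) \<le> \<delta>" if "\<delta> \<in> D" for \<delta>
        using that x False unfolding D_def block_RIP_bound_def c_def
        by (auto simp: field_simps)
    qed
    then show ?thesis using False unfolding c_def by (auto simp: field_simps)
  qed simp
  moreover have "0 \<le> Inf D"
    using \<delta>0 by (intro cInf_greatest) (auto simp: D_def block_RIP_bound_def)
  moreover have "Inf D < 1"
    using cInf_lower[OF \<delta>0 bdd] \<delta>0 by (auto simp: D_def block_RIP_bound_def)
  ultimately have "block_RIP_bound A d l s (Inf D)" by (simp add: block_RIP_bound_def)
  moreover from this have "block_RIC A d l s = Inf D"
    unfolding block_RIC_def using cInf_lower[OF _ bdd]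
    by (intro Least_equality) (auto simp: D_def)
  ultimately show ?thesis by simp
qed

lemma block_RIP_bound_lower:
  assumes "block_RIP_bound A d l s \<delta>" "block_sparse d l s x"
  shows "sqrt (1 - \<delta>) * norm x \<le> norm (A *v x)"
proof (rule power2_le_imp_le)
  show "(sqrt (1 - \<delta>) * norm x)\<^sup>2 \<le> (norm (A *v x))\<^sup>2"
    using assms by (auto simp: block_RIP_bound_def power_mult_distrib)
qed simp

lemma block_RIP_bound_upper:
  assumes "block_RIP_bound A d l s \<delta>" "block_sparse d l s x"
  shows "norm (A *v x) \<le> sqrt (1 + \<delta>) * norm x"
proof (rule power2_le_imp_le)
  show "(norm (A *v x))\<^sup>2 \<le> (sqrt (1 + \<delta>) * norm x)\<^sup>2"
    using assms by (auto simp: block_RIP_bound_def power_mult_distrib)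
  show "0 \<le> sqrt (1 + \<delta>) * norm x"
    using assms by (simp add: block_RIP_bound_def)
qed

text \<open>Polarization, applied to \<open>norm q *\<^sub>R w\<close> plus and minus \<open>norm w *\<^sub>R q\<close>.\<close>

lemma block_RIP_bound_inner_le:
  fixes w q :: "real^'n::{finite,linorder}"
  assumes rip: "block_RIP_bound A d l s \<delta>"
    and w: "block_supp d l w \<subseteq> \<Gamma>" and q: "block_supp d l q \<subseteq> \<Gamma>"
    and \<Gamma>: "finite \<Gamma>" "card \<Gamma> \<le> s"
  shows "(A *v w) \<bullet> (A *v q) \<le> w \<bullet> q + \<delta> * norm w * norm q"
proof (cases "w = 0 \<or> q = 0")
  case True
  then show ?thesis by auto
next
  case False
  define a b where "a = norm w" and "b = norm q"
  have pos: "a * b > 0" using False by (simp add: a_def b_def)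
  define P M where "P = b *\<^sub>R w + a *\<^sub>R q" and "M = b *\<^sub>R w + (- a) *\<^sub>R q"
  have "block_supp d l P \<subseteq> \<Gamma>" "block_supp d l M \<subseteq> \<Gamma>"
    unfolding P_def M_def by (rule block_supp_lincomb[OF w q])+
  then have "block_sparse d l s P" "block_sparse d l s M"
    by (auto intro: block_sparseI \<Gamma>)
  then have le: "(norm (A *v P))\<^sup>2 - (norm (A *v M))\<^sup>2 \<le> (1 + \<delta>) * (norm P)\<^sup>2 - (1 - \<delta>) * (norm M)\<^sup>2"
    using rip by (meson block_RIP_bound_def diff_mono)
  have AP: "A *v P = b *\<^sub>R (A *v w) + a *\<^sub>R (A *v q)"
    and AM: "A *v M = b *\<^sub>R (A *v w) - a *\<^sub>R (A *v q)"
    by (simp_all add: P_def M_def matrix_vector_right_distrib matrix_vector_mult_diff_distrib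
          matrix_vector_mult_scaleR)
  have lhs: "(norm (A *v P))\<^sup>2 - (norm (A *v M))\<^sup>2 = 4 * (a * b) * ((A *v w) \<bullet> (A *v q))"
    unfolding AP AM power2_norm_eq_inner
    by (simp add: inner_left_distrib inner_right_distrib inner_diff_left inner_diff_right
          inner_commute algebra_simps)
  have norm_P: "(norm P)\<^sup>2 = 2 * (a * b)\<^sup>2 + 2 * (a * b) * (w \<bullet> q)"
    and norm_M: "(norm M)\<^sup>2 = 2 * (a * b)\<^sup>2 - 2 * (a * b) * (w \<bullet> q)"
  proof -
    have "w \<bullet> w = a\<^sup>2" "q \<bullet> q = b\<^sup>2" by (simp_all add: a_def b_def power2_norm_eq_inner)
    then show "(norm P)\<^sup>2 = 2 * (a * b)\<^sup>2 + 2 * (a * b) * (w \<bullet> q)"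
      and "(norm M)\<^sup>2 = 2 * (a * b)\<^sup>2 - 2 * (a * b) * (w \<bullet> q)"
      unfolding P_def M_def power2_norm_eq_inner
      by (simp_all add: inner_left_distrib inner_right_distrib inner_diff_left inner_diff_right
            inner_commute power2_eq_square algebra_simps)
  qed
  \<comment> \<open>After the scaling both summands have norm \<open>a * b\<close>. The difference
    of the two RIP bounds therefore collapses to \<open>4 * (a * b)\<close> times the claimed
    bound.\<close>
  have "4 * (a * b) * ((A *v w) \<bullet> (A *v q)) \<le> 4 * (a * b) * (w \<bullet> q + \<delta> * (a * b))"
    using le[unfolded lhs norm_P norm_M] by (simp add: algebra_simps power2_eq_square)
  then have "(A *v w) \<bullet> (A *v q) \<le> w \<bullet> q + \<delta> * (a * b)"
    by (rule mult_left_le_imp_le) (use pos in simp)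
  then show ?thesis by (simp add: a_def b_def mult.assoc)
qed

section \<open>Orthogonality of the least-squares residual\<close>

text \<open>Moving from \<open>u\<close> to \<open>u + c *\<^sub>R v\<close>, with \<open>c\<close>
  the projection coefficient of the residual on \<open>A *v v\<close>, would lower the squared
  residual by \<open>(r \<bullet> g)\<^sup>2 / (g \<bullet> g)\<close>. Minimality forces this gain
  to vanish.\<close>

lemma least_squares_orthogonal:
  assumes "least_squares A d l y \<Lambda> u" and v: "block_supp d l v \<subseteq> \<Lambda>"
  shows "(y - A *v u) \<bullet> (A *v v) = 0"
proof -
  have u: "block_supp d l u \<subseteq> \<Lambda>"
    using assms(1) by (simp add: least_squares_def is_arg_min_linorder)
  have min: "norm (y - A *v u) \<le> norm (y - A *v u')" if "block_supp d l u' \<subseteq> \<Lambda>" for u'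
    using assms(1) that by (simp add: least_squares_def is_arg_min_linorder)
  define r g where "r = y - A *v u" and "g = A *v v"
  show ?thesis
  proof (cases "g = 0")
    case False
    define c where "c = (r \<bullet> g) / (g \<bullet> g)"
    have "block_supp d l (u + c *\<^sub>R v) \<subseteq> \<Lambda>"
      by (intro block_supp_add block_supp_scaleR u v)
    then have "norm r \<le> norm (y - A *v (u + c *\<^sub>R v))" unfolding r_def by (rule min)
    also have "y - A *v (u + c *\<^sub>R v) = r - c *\<^sub>R g"
      by (simp add: r_def g_def matrix_vector_right_distrib matrix_vector_mult_scaleR)
    finally have "r \<bullet> r \<le> (r - c *\<^sub>R g) \<bullet> (r - c *\<^sub>R g)" by (simp add: norm_le)
    also have "\<dots> = r \<bullet> r - (r \<bullet> g)\<^sup>2 / (g \<bullet> g)"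
      using False unfolding c_def
      by (simp add: inner_diff_left inner_diff_right inner_commute power2_eq_square field_simps)
    finally have "(r \<bullet> g)\<^sup>2 / (g \<bullet> g) \<le> 0" by simp
    moreover have "g \<bullet> g > 0" using False by simp
    ultimately have "(r \<bullet> g)\<^sup>2 \<le> 0" by (simp only: divide_le_0_iff) auto
    then show ?thesis unfolding r_def g_def by simp
  qed (simp add: g_def)
qed

text \<open>Tests orthogonality against the \<open>i\<close>-th block of the correlation vector
  itself, which yields the square of its block norm.\<close>

lemma least_squares_block_norm_eq_0:
  fixes A :: "real^'n::{finite,linorder}^'m"
  assumes "(\<Sum>i=1..l. d i) = CARD('n)"
    and "least_squares A d l y \<Lambda> u" and "i \<in> \<Lambda>" and "i \<in> {1..l}"
  shows "block_norm d (transpose A *v (y - A *v u)) i = 0"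
proof -
  define h where "h = transpose A *v (y - A *v u)"
  have "block_supp d l (block_restrict d {i} h) \<subseteq> \<Lambda>"
    using block_supp_restrict[of d l "{i}" h] assms(3) by blast
  then have "h \<bullet> block_restrict d {i} h = 0"
    unfolding h_def inner_transpose_matrix_vector by (rule least_squares_orthogonal[OF assms(2)])
  then show ?thesis
    using assms(4) unfolding h_def[symmetric]
    by (simp add: inner_block_restrict[OF assms(1)] block_norm_power2[symmetric])
qed

section \<open>Correctness of one identification step\<close>

text \<open>In the application \<open>w\<close> is the error \<open>x - u k\<close> and
  \<open>D\<close> the part of the support still to be found. The RIP is applied only to vectors
  supported in \<open>S \<union> (D \<union> \<Lambda>)\<close>, whose size is left to the caller to
  count.\<close>

lemma largest_indices_meet_support:
  fixes A :: "real^'n::{finite,linorder}^'m" and w :: "real^'n::{finite,linorder}"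
  assumes d_sum: "(\<Sum>i=1..l. d i) = CARD('n)"
    and rip: "block_RIP_bound A d l s \<delta>"
    and r_eq: "r = A *v w + e"
    and noise: "norm e \<le> \<epsilon>" "\<epsilon> < norm (A *v w)"
    and S: "largest_indices l N (block_norm d (transpose A *v r)) S"
    and w: "block_supp d l w \<subseteq> D \<union> \<Lambda>"
    and D: "D \<subseteq> {1..l}" "D \<noteq> {}" "card D \<le> K"
    and \<Lambda>: "\<Lambda> \<subseteq> {1..l}" "\<And>i. i \<in> \<Lambda> \<Longrightarrow> block_norm d (transpose A *v r) i = 0"
    and card: "card (S \<union> (D \<union> \<Lambda>)) \<le> s"
    and NK: "0 < N" "0 < K"
    and large: "sqrt (1 + \<delta>) * \<epsilon> < (1 / sqrt (real K / real N + 1) - \<delta>) * norm w"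
  shows "S \<inter> D \<noteq> {}"
proof
  assume disj: "S \<inter> D = {}"
  define h where "h = transpose A *v r"
  define g where "g = block_restrict d S h"
  have S': "S \<subseteq> {1..l}" "card S = min N l"
      "\<And>i j. i \<in> S \<Longrightarrow> j \<in> {1..l} - S \<Longrightarrow> block_norm d h j \<le> block_norm d h i"
    using S by (auto simp: largest_indices_def h_def)
  have fin: "finite S" "finite D" "finite \<Lambda>"
    using S'(1) D(1) \<Lambda>(1) by (auto intro: finite_subset)
  \<comment> \<open>An index of \<open>D\<close> lies outside \<open>S\<close>, so there were more
    than \<open>N\<close> blocks to choose from and the \<open>min\<close> in
    \<open>largest_indices\<close> is \<open>N\<close>.\<close>
  have "S \<noteq> {1..l}" using disj D(1,2) by blast
  then have "card S \<noteq> l" using card_subset_eq[OF _ S'(1)] by auto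
  then have card_S: "card S = N" using S'(2) by linarith
  \<comment> \<open>\<open>M\<close> separates the two sets: no block of \<open>D\<close> exceeds
    it, and every selected block reaches it.\<close>
  define M where "M = Max (block_norm d h ` D)"
  have M_ge: "block_norm d h i \<le> M" if "i \<in> D" for i
    unfolding M_def using that fin by simp
  have "M \<in> block_norm d h ` D" unfolding M_def using fin D by (intro Max_in) auto
  then obtain j where j: "j \<in> D" "M = block_norm d h j" by auto
  have M_nonneg: "0 \<le> M" by (simp add: j block_norm_nonneg)
  have M_le: "M \<le> block_norm d h i" if "i \<in> S" for i
    unfolding j(2) using S'(3)[OF that] j(1) D(1) disj by blast
  have sum_D: "(\<Sum>i\<in>D. block_norm d w i) \<le> sqrt K * norm w"
  proof -
    have "(\<Sum>i\<in>D. block_norm d w i) = (\<Sum>i\<in>D. \<bar>1\<bar> * \<bar>block_norm d w i\<bar>)"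
      by (simp add: block_norm_nonneg)
    also have "\<dots> \<le> L2_set (\<lambda>i. 1) D * L2_set (block_norm d w) D"
      by (rule L2_set_mult_ineq)
    also have "\<dots> \<le> sqrt K * norm w"
    proof (rule mult_mono)
      show "L2_set (\<lambda>i. 1) D \<le> sqrt K" using D(3) by (simp add: L2_set_def)
      have "(\<Sum>i\<in>D. (block_norm d w i)\<^sup>2) \<le> (norm w)\<^sup>2"
        unfolding norm_power2_blocks[OF d_sum] using D(1) by (intro sum_mono2) auto
      then show "L2_set (block_norm d w) D \<le> norm w"
        unfolding L2_set_def by (simp add: real_le_lsqrt)
    qed auto
    finally show ?thesis .
  qed
  have hw: "h \<bullet> w \<le> M * (sqrt K * norm w)"
  proof -
    have "h \<bullet> w = (\<Sum>i\<in>D. \<Sum>p\<in>block d i. h $ p * w $ p)"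
      unfolding inner_blocks[OF d_sum]
    proof (rule sum.mono_neutral_right)
      show "\<forall>i\<in>{1..l} - D. (\<Sum>p\<in>block d i. h $ p * w $ p) = 0"
      proof
        fix i assume i: "i \<in> {1..l} - D"
        have "(\<forall>p\<in>block d i. h $ p = 0) \<or> (\<forall>p\<in>block d i. w $ p = 0)"
        proof (cases "i \<in> \<Lambda>")
          case True
          then show ?thesis using \<Lambda>(2) by (simp add: h_def block_norm_eq_0_iff)
        next
          case False
          then show ?thesis using w i unfolding block_supp_subset_iff by blast
        qed
        then show "(\<Sum>p\<in>block d i. h $ p * w $ p) = 0" by auto
      qed
    qed (use D in auto)
    also have "\<dots> \<le> (\<Sum>i\<in>D. M * block_norm d w i)"
      by (intro sum_mono order.trans[OF block_inner_le] mult_right_mono M_ge block_norm_nonneg)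
    also have "\<dots> \<le> M * (sqrt K * norm w)"
      unfolding sum_distrib_left[symmetric] by (rule mult_left_mono[OF sum_D M_nonneg])
    finally show ?thesis .
  qed
  have g: "sqrt N * M \<le> norm g"
  proof (rule power2_le_imp_le)
    have "(sqrt N * M)\<^sup>2 = (\<Sum>i\<in>S. M\<^sup>2)" by (simp add: card_S power_mult_distrib)
    also have "\<dots> \<le> (\<Sum>i\<in>S. (block_norm d h i)\<^sup>2)"
      by (intro sum_mono power_mono M_le M_nonneg)
    also have "\<dots> = (norm g)\<^sup>2"
      unfolding g_def by (rule norm_block_restrict_power2[OF d_sum S'(1), symmetric])
    finally show "(sqrt N * M)\<^sup>2 \<le> (norm g)\<^sup>2" .
  qed simp
  \<comment> \<open>With this value \<open>\<sigma> * sqrt K = sqrt N\<close>, which makes the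
    bounds on \<open>h \<bullet> w\<close> and \<open>norm g\<close> comparable.\<close>
  define \<sigma> where "\<sigma> = sqrt (real N / real K)"
  have \<sigma>_pos: "\<sigma> > 0" using NK by (simp add: \<sigma>_def)
  have "\<sigma> * (h \<bullet> w) \<le> \<sigma> * (M * (sqrt K * norm w))"
    using hw \<sigma>_pos by simp
  also have "\<dots> = sqrt N * M * norm w"
    using NK by (simp add: \<sigma>_def real_sqrt_divide)
  also have "\<dots> \<le> norm g * norm w" by (intro mult_right_mono g) simp
  finally have hw_le: "\<sigma> * (h \<bullet> w) \<le> norm g * norm w" .

  \<comment> \<open>Since the signal part \<open>A *v w\<close> outweighs the noise,
    \<open>h \<bullet> w\<close> is positive. This excludes \<open>g = 0\<close> and
    \<open>w = 0\<close> and permits the division in \<open>z\<close>.\<close>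
  have "h \<bullet> w = norm (A *v w)^2 + e \<bullet> (A *v w)"
    unfolding h_def inner_transpose_matrix_vector r_eq
    by (simp add: inner_left_distrib power2_norm_eq_inner)
  moreover have "\<bar>e \<bullet> (A *v w)\<bar> \<le> \<epsilon> * norm (A *v w)"
    using Cauchy_Schwarz_ineq2[of e "A *v w"] noise(1) by (meson mult_right_mono norm_ge_zero order.trans)
  moreover have "\<epsilon> * norm (A *v w) < norm (A *v w)^2"
    using noise norm_ge_zero[of e] unfolding power2_eq_square by (intro mult_strict_right_mono) linarith+
  ultimately have "h \<bullet> w > 0" by linarith
  then have "norm g * norm w > 0" using hw_le \<sigma>_pos by (meson mult_pos_pos order.strict_trans2)
  then have pos: "norm g > 0" "norm w > 0" by (simp_all add: zero_less_mult_iff)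

  define z where "z = (norm w / norm g) *\<^sub>R g"
  define q where "q = z - \<sigma> *\<^sub>R w"
  have "h \<bullet> g = (norm g)\<^sup>2"
    unfolding g_def norm_block_restrict_power2[OF d_sum S'(1)] inner_block_restrict[OF d_sum S'(1)]
      block_norm_power2 ..
  then have "h \<bullet> z = norm g * norm w"
    using pos by (simp add: z_def power2_eq_square)
  then have hq: "0 \<le> h \<bullet> q" using hw_le by (simp add: q_def inner_diff_right)
  \<comment> \<open>The new indices lie outside \<open>D\<close>, and \<open>h\<close> vanishes on \<open>\<Lambda>\<close>.\<close>
  have "w \<bullet> g = (\<Sum>i\<in>S. \<Sum>p\<in>block d i. w $ p * h $ p)"
    unfolding g_def by (rule inner_block_restrict[OF d_sum S'(1)])
  also have "\<dots> = 0"
  proof (intro sum.neutral ballI)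
    fix i assume i: "i \<in> S"
    have "(\<forall>p\<in>block d i. h $ p = 0) \<or> (\<forall>p\<in>block d i. w $ p = 0)"
    proof (cases "i \<in> \<Lambda>")
      case True
      then show ?thesis using \<Lambda>(2) by (simp add: h_def block_norm_eq_0_iff)
    next
      case False
      then show ?thesis using w i disj S'(1) unfolding block_supp_subset_iff by blast
    qed
    then show "w $ p * h $ p = 0" if "p \<in> block d i" for p using that by auto
  qed
  finally have wz: "w \<bullet> z = 0" by (simp add: z_def)
  have norm_z: "norm z = norm w" using pos by (simp add: z_def)
  have wq: "w \<bullet> q = - \<sigma> * (norm w)\<^sup>2"
    by (simp add: q_def inner_diff_right wz power2_norm_eq_inner)
  have "(norm q)\<^sup>2 = (norm z)\<^sup>2 + \<sigma>\<^sup>2 * (norm w)\<^sup>2"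
    using wz unfolding q_def power2_norm_eq_inner
    by (simp add: inner_diff_left inner_diff_right inner_commute power2_eq_square)
  also have "\<dots> = (sqrt (1 + \<sigma>\<^sup>2) * norm w)\<^sup>2"
    by (simp add: norm_z power_mult_distrib algebra_simps)
  finally have norm_q: "norm q = sqrt (1 + \<sigma>\<^sup>2) * norm w"
    by (rule power2_eq_imp_eq) auto

  have supp_w: "block_supp d l w \<subseteq> S \<union> (D \<union> \<Lambda>)" using w by blast
  have supp_q: "block_supp d l q \<subseteq> S \<union> (D \<union> \<Lambda>)"
    unfolding q_def z_def g_def
    by (intro block_supp_diff block_supp_scaleR supp_w) (use block_supp_restrict in blast)
  have fin_all: "finite (S \<union> (D \<union> \<Lambda>))" using fin by simp
  have "h \<bullet> q = (A *v w) \<bullet> (A *v q) + e \<bullet> (A *v q)"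
    unfolding h_def inner_transpose_matrix_vector r_eq by (rule inner_left_distrib)
  also have "(A *v w) \<bullet> (A *v q) \<le> w \<bullet> q + \<delta> * norm w * norm q"
    by (rule block_RIP_bound_inner_le[OF rip supp_w supp_q fin_all card])
  also have "e \<bullet> (A *v q) \<le> \<epsilon> * (sqrt (1 + \<delta>) * norm q)"
  proof -
    have "e \<bullet> (A *v q) \<le> norm e * norm (A *v q)" by (rule norm_cauchy_schwarz)
    also have "\<dots> \<le> \<epsilon> * (sqrt (1 + \<delta>) * norm q)"
      using noise(1) order.trans[OF norm_ge_zero noise(1)]
      by (intro mult_mono block_RIP_bound_upper[OF rip block_sparseI[OF supp_q fin_all card]]) auto
    finally show ?thesis .
  qed
  finally have "0 \<le> w \<bullet> q + \<delta> * norm w * norm q + \<epsilon> * (sqrt (1 + \<delta>) * norm q)"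
    using hq by linarith
  also have "\<dots> = norm w * (\<delta> * sqrt (1 + \<sigma>\<^sup>2) * norm w + sqrt (1 + \<delta>) * \<epsilon> * sqrt (1 + \<sigma>\<^sup>2) - \<sigma> * norm w)"
    by (simp add: wq norm_q power2_eq_square algebra_simps)
  finally have "\<sigma> * norm w \<le> sqrt (1 + \<sigma>\<^sup>2) * (\<delta> * norm w + sqrt (1 + \<delta>) * \<epsilon>)"
    using pos(2) unfolding zero_le_mult_iff by (auto simp: distrib_left ac_simps)
  \<comment> \<open>Turns \<open>\<sigma> / sqrt (1 + \<sigma>\<^sup>2)\<close> into the threshold
    \<open>1 / sqrt (K / N + 1)\<close> on the constant.\<close>
  moreover have "\<sigma> = sqrt (1 + \<sigma>\<^sup>2) * (1 / sqrt (real K / real N + 1))"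
  proof -
    have "\<sigma>\<^sup>2 = real N / real K" by (simp add: \<sigma>_def)
    then have "\<sigma>\<^sup>2 * (real K / real N + 1) = 1 + \<sigma>\<^sup>2" using NK by (simp add: field_simps)
    then have "\<sigma> * sqrt (real K / real N + 1) = sqrt (1 + \<sigma>\<^sup>2)"
      using \<sigma>_pos by (metis abs_of_pos real_sqrt_abs real_sqrt_mult)
    moreover have "sqrt (real K / real N + 1) > 0" by (simp add: add_nonneg_pos)
    ultimately show ?thesis by (simp add: field_simps)
  qed
  ultimately have "sqrt (1 + \<sigma>\<^sup>2) * (1 / sqrt (real K / real N + 1) * norm w)
      \<le> sqrt (1 + \<sigma>\<^sup>2) * (\<delta> * norm w + sqrt (1 + \<delta>) * \<epsilon>)"
    by (metis mult.assoc)
  moreover have "sqrt (1 + \<sigma>\<^sup>2) > 0" by (simp add: add_pos_nonneg)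
  ultimately have "1 / sqrt (real K / real N + 1) * norm w \<le> \<delta> * norm w + sqrt (1 + \<delta>) * \<epsilon>"
    using mult_le_cancel_left_pos by blast
  then show False using large by (simp add: left_diff_distrib)
qed

section \<open>Induction over the passes of the algorithm\<close>

text \<open>The index \<open>k\<close> is at once the first pass meeting the stopping rule and the
  first covering the support. For \<open>N > 1\<close> the set \<open>\<Lambda> k\<close> may
  contain further indices. With noise, the support of \<open>u k\<close> is then only enclosed
  between the true support and \<open>\<Lambda> k\<close>.\<close>

theorem theorem3p5:
  fixes A :: "real^'n::{finite,linorder}^'m"
    and x :: "real^'n::{finite,linorder}" and e y :: "real^'m"
    and d :: "nat \<Rightarrow> nat" and l K N :: nat and \<epsilon> \<delta> :: real
    and \<Lambda> :: "nat \<Rightarrow> nat set" and u :: "nat \<Rightarrow> real^'n::{finite,linorder}" and r :: "nat \<Rightarrow> real^'m"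
  assumes d_pos: "\<forall>i\<in>{1..l}. 0 < d i"
    and d_sum: "(\<Sum>i=1..l. d i) = CARD('n)"
    and N_ge_1: "1 \<le> N"
    and N_le_K: "N \<le> K"
    and N_le: "real N \<le> real CARD('m) / real K"
    and sparse: "block_sparse d l K x"
    and y_eq: "y = A *v x + e"
    and noise: "norm e \<le> \<epsilon>"
    and rip: "block_RIP A d l (N * K + 1)"
    and \<delta>_eq: "\<delta> = block_RIC A d l (N * K + 1)"
    and \<delta>_less: "\<delta> < 1 / sqrt (real K / real N + 1)"
    and large: "\<forall>i\<in>block_supp d l x.
        block_norm d x i >
          max ((sqrt (2 * real K * (1 + \<delta>)) * \<epsilon> / sqrt (real K / real N + 1))
                 / (1 / sqrt (real K / real N + 1) - \<delta>))
              (2 * \<epsilon> / sqrt (1 - \<delta>))"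
    and run: "bommp_run A d l N \<epsilon> y \<Lambda> u r"
  shows "\<exists>k \<le> card (block_supp d l x).
           norm (r k) \<le> \<epsilon> \<and> block_supp d l x \<subseteq> \<Lambda> k \<and>
           (\<forall>j<k. norm (r j) > \<epsilon> \<and> \<not> block_supp d l x \<subseteq> \<Lambda> j) \<and>
           block_supp d l x \<subseteq> block_supp d l (u k) \<and> block_supp d l (u k) \<subseteq> \<Lambda> k \<and>
           (N = 1 \<longrightarrow> \<Lambda> k = block_supp d l x) \<and>
           (N = 1 \<or> \<epsilon> = 0 \<longrightarrow> block_supp d l (u k) = block_supp d l x)"
proof -
  define T where "T = block_supp d l x"
  define \<alpha> where "\<alpha> = sqrt (real K / real N + 1)"
  have ripb: "block_RIP_bound A d l (N * K + 1) \<delta>"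
    unfolding \<delta>_eq by (rule block_RIP_bound_block_RIC[OF rip])
  then have \<delta>: "0 \<le> \<delta>" "\<delta> < 1" by (auto simp: block_RIP_bound_def)
  have K: "0 < K" using N_ge_1 N_le_K by simp
  have \<epsilon>: "0 \<le> \<epsilon>" using noise norm_ge_zero order.trans by blast
  have T: "T \<subseteq> {1..l}" "finite T" "card T \<le> K"
    using sparse by (auto simp: T_def block_supp_def block_sparse_def)
  have x_supp: "block_supp d l x \<subseteq> T" by (simp add: T_def)

  \<comment> \<open>The lower bound on the blocks enters only here: if \<open>v\<close> vanishes on
    a block of the support, \<open>x - v\<close> is at least as large as that block of
    \<open>x\<close>.\<close>
  have big: "2 * \<epsilon> < sqrt (1 - \<delta>) * norm (x - v)"
      "sqrt (1 + \<delta>) * \<epsilon> < (1 / \<alpha> - \<delta>) * norm (x - v)"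
    if "i \<in> T" "block_norm d v i = 0" for i and v :: "real^'n::{finite,linorder}"
  proof -
    have "block_norm d x i = block_norm d (x - v) i"
      using that(2) unfolding block_norm_eq_0_iff by (simp add: block_norm_def cong: L2_set_cong)
    also have "\<dots> \<le> norm (x - v)" by (rule block_norm_le_norm)
    finally have large': "(sqrt (2 * K * (1 + \<delta>)) * \<epsilon> / \<alpha>) / (1 / \<alpha> - \<delta>) < norm (x - v)"
        "2 * \<epsilon> / sqrt (1 - \<delta>) < norm (x - v)"
      using large that(1) unfolding T_def \<alpha>_def by (fastforce)+
    then show "2 * \<epsilon> < sqrt (1 - \<delta>) * norm (x - v)" using \<delta> by (simp add: field_simps)
    have \<alpha>_pos: "\<alpha> > 0" by (simp add: \<alpha>_def add_nonneg_pos)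
    have "real K / real N + 1 \<le> 2 * K"
    proof -
      have "real K / real N \<le> K" using N_ge_1 by (simp add: divide_le_eq mult_le_cancel_left1)
      then show ?thesis using K by linarith
    qed
    then have "\<alpha> \<le> sqrt (2 * K)" unfolding \<alpha>_def by (rule real_sqrt_le_mono)
    then have "sqrt (1 + \<delta>) * \<epsilon> * \<alpha> \<le> sqrt (1 + \<delta>) * \<epsilon> * sqrt (2 * K)"
      using \<delta> \<epsilon> by (intro mult_left_mono) auto
    then have "sqrt (1 + \<delta>) * \<epsilon> \<le> sqrt (2 * K * (1 + \<delta>)) * \<epsilon> / \<alpha>"
      unfolding real_sqrt_mult[of _ "1 + \<delta>"] using \<alpha>_pos by (simp add: le_divide_eq ac_simps)
    also have "\<dots> < (1 / \<alpha> - \<delta>) * norm (x - v)"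
    proof -
      have "1 / \<alpha> - \<delta> > 0" using \<delta>_less by (simp add: \<alpha>_def)
      then show ?thesis using large'(1) by (simp only: pos_divide_less_eq mult.commute)
    qed
    finally show "sqrt (1 + \<delta>) * \<epsilon> < (1 / \<alpha> - \<delta>) * norm (x - v)" .
  qed

  \<comment> \<open>The count \<open>k \<le> card (T \<inter> \<Lambda> k)\<close> records that each
    pass found a new index of the support; it bounds both the number of passes and the RIP order
    required.\<close>
  define invar where "invar k \<longleftrightarrow> (\<forall>j<k. norm (r j) > \<epsilon>) \<and> \<Lambda> k \<subseteq> {1..l} \<and> card (\<Lambda> k) \<le> N * k \<and>
      k \<le> card (T \<inter> \<Lambda> k) \<and> r k = y - A *v u k \<and> least_squares A d l y (\<Lambda> k) (u k)" for k
  have r_eq: "r k = A *v (x - u k) + e" if "invar k" for k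
    using that by (simp add: invar_def y_eq matrix_vector_mult_diff_distrib)
  have u_supp: "block_supp d l (u k) \<subseteq> \<Lambda> k" if "invar k" for k
    using that by (simp add: invar_def least_squares_def is_arg_min_linorder)
  have fin: "finite (\<Lambda> k)" if "invar k" for k
    using that unfolding invar_def by (meson finite_atLeastAtMost finite_subset)

  \<comment> \<open>Source of the order \<open>N * K + 1\<close>. With
    \<open>c = card (T - \<Lambda> k) \<ge> 1\<close> the invariant gives
    \<open>k + c \<le> K\<close>, and \<open>N + c \<le> N * c + 1\<close> because
    \<open>(N - 1) * (c - 1) \<ge> 0\<close>.\<close>
  have card_le: "N + (card (T - \<Lambda> k) + card (\<Lambda> k)) \<le> N * K + 1"
    if k: "invar k" "\<not> T \<subseteq> \<Lambda> k" for k
  proof -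
    have "card (T - \<Lambda> k) > 0" using k(2) T(2) by (simp add: card_gt_0_iff)
    moreover have "card (T - \<Lambda> k) + card (T \<inter> \<Lambda> k) = card T"
      using T(2) by (metis add.commute card_Int_Diff)
    moreover have "k \<le> card (T \<inter> \<Lambda> k)" "card (\<Lambda> k) \<le> N * k" using k(1) by (auto simp: invar_def)
    ultimately obtain a where a: "card (T - \<Lambda> k) = Suc a" "k + Suc a \<le> K"
      using T(3) by (metis Suc_pred' add.commute add_left_mono order.trans)
    obtain b where b: "N = Suc b" using N_ge_1 by (metis Suc_pred' Suc_le_eq One_nat_def)
    have "N * (k + Suc a) \<le> N * K" using a(2) by (rule mult_le_mono2)
    moreover have "N + Suc a \<le> N * Suc a + 1" by (simp add: b)
    ultimately show ?thesis
      using \<open>card (\<Lambda> k) \<le> N * k\<close> unfolding a(1) add_mult_distrib2 by linarith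
  qed

  have step: "norm (r k) > \<epsilon> \<and>
      (\<forall>S. largest_indices l N (block_norm d (transpose A *v r k)) S \<longrightarrow> S \<inter> (T - \<Lambda> k) \<noteq> {})"
    if k: "invar k" "\<not> T \<subseteq> \<Lambda> k" for k
  proof -
    obtain i where i: "i \<in> T" "i \<notin> \<Lambda> k" using k(2) by blast
    have "block_norm d (u k) i = 0"
      using i T(1) u_supp[OF k(1)] block_norm_nonneg[of d "u k" i]
      unfolding block_supp_def by fastforce
    note big = big[OF i(1) this]
    have supp: "block_supp d l (x - u k) \<subseteq> (T - \<Lambda> k) \<union> \<Lambda> k"
      using x_supp u_supp[OF k(1)] by (intro block_supp_diff) auto
    have "card ((T - \<Lambda> k) \<union> \<Lambda> k) \<le> N * K + 1"
      using card_le[OF k] card_Un_le[of "T - \<Lambda> k" "\<Lambda> k"] by linarith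
    then have "block_sparse d l (N * K + 1) (x - u k)"
      using T(2) fin[OF k(1)] by (intro block_sparseI[OF supp]) auto
    note block_RIP_bound_lower[OF ripb this]
    \<comment> \<open>The factor 2 leaves room for the noise: subtracting
      \<open>norm e \<le> \<epsilon>\<close> keeps the residual above the tolerance.\<close>
    then have Aw: "2 * \<epsilon> < norm (A *v (x - u k))" using big(1) by linarith
    also have "\<dots> \<le> norm (r k) + norm e"
      using norm_triangle_ineq4[of "r k" e] by (simp add: r_eq[OF k(1)])
    finally have "norm (r k) > \<epsilon>" using noise by linarith
    moreover have "S \<inter> (T - \<Lambda> k) \<noteq> {}"
      if S: "largest_indices l N (block_norm d (transpose A *v r k)) S" for S
    proof (rule largest_indices_meet_support[OF d_sum ripb r_eq[OF k(1)] noise _ S supp])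
      show "\<epsilon> < norm (A *v (x - u k))" using Aw \<epsilon> by linarith
      show "block_norm d (transpose A *v r k) i = 0" if "i \<in> \<Lambda> k" for i
        using least_squares_block_norm_eq_0[OF d_sum, of A y "\<Lambda> k" "u k" i] k(1) that
        by (auto simp: invar_def)
      show "card (T - \<Lambda> k) \<le> K" using T(2,3) card_mono[of T "T - \<Lambda> k"] by auto
      have "card S \<le> N" using S by (simp add: largest_indices_def)
      then show "card (S \<union> (T - \<Lambda> k \<union> \<Lambda> k)) \<le> N * K + 1"
        using card_le[OF k] card_Un_le[of S "T - \<Lambda> k \<union> \<Lambda> k"] card_Un_le[of "T - \<Lambda> k" "\<Lambda> k"]
        by linarith
      show "sqrt (1 + \<delta>) * \<epsilon> < (1 / sqrt (real K / real N + 1) - \<delta>) * norm (x - u k)"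
        using big(2) by (simp add: \<alpha>_def)
    qed (use k T(1) K N_ge_1 in \<open>auto simp: invar_def\<close>)
    ultimately show ?thesis by blast
  qed

  have invar: "invar k" if "\<forall>j<k. \<not> T \<subseteq> \<Lambda> j" for k
    using that
  proof (induction k)
    case 0
    \<comment> \<open>Only the zero vector has empty block support, so the initial estimate already
      counts as a least-squares solution.\<close>
    have "least_squares A d l y {} 0"
      using block_supp_eq_empty_iff[OF d_sum]
      by (auto simp: least_squares_def is_arg_min_linorder)
    then show ?case using run by (simp add: invar_def bommp_run_def)
  next
    case (Suc k)
    then have k: "invar k" "\<not> T \<subseteq> \<Lambda> k" by auto
    have resid: "\<forall>j\<le>k. norm (r j) > \<epsilon>"
      using step[OF k] k(1) by (auto simp: invar_def le_less)
    then obtain S where S: "largest_indices l N (block_norm d (transpose A *v r k)) S"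
      and Suc_k: "\<Lambda> (Suc k) = \<Lambda> k \<union> S" "least_squares A d l y (\<Lambda> (Suc k)) (u (Suc k))"
        "r (Suc k) = y - A *v u (Suc k)"
      using run unfolding bommp_run_def by blast
    have S': "S \<subseteq> {1..l}" "card S \<le> N" using S by (auto simp: largest_indices_def)
    have "card (\<Lambda> (Suc k)) \<le> N * Suc k"
      using card_Un_le[of "\<Lambda> k" S] S'(2) k(1) by (simp add: Suc_k invar_def)
    moreover have "T \<inter> \<Lambda> k \<subset> T \<inter> \<Lambda> (Suc k)"
      using step[OF k] S unfolding Suc_k by blast
    then have "card (T \<inter> \<Lambda> k) < card (T \<inter> \<Lambda> (Suc k))"
      using T(2) by (intro psubset_card_mono) auto
    ultimately show ?case
      using k(1) S'(1) Suc_k resid by (auto simp: invar_def less_Suc_eq_le)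
  qed

  have "\<exists>k. T \<subseteq> \<Lambda> k"
  proof (rule ccontr)
    assume "\<not> ?thesis"
    \<comment> \<open>After \<open>card T + 1\<close> unsuccessful passes more indices of
      \<open>T\<close> would have been found than \<open>T\<close> has.\<close>
    then have "invar (Suc (card T))" using invar by blast
    then have "Suc (card T) \<le> card (T \<inter> \<Lambda> (Suc (card T)))" by (simp add: invar_def)
    also have "\<dots> \<le> card T" using T(2) by (intro card_mono) auto
    finally show False by simp
  qed
  define k where "k = (LEAST k. T \<subseteq> \<Lambda> k)"
  have T_sub: "T \<subseteq> \<Lambda> k" unfolding k_def using \<open>\<exists>k. T \<subseteq> \<Lambda> k\<close> by (rule LeastI_ex)
  have not_sub: "\<not> T \<subseteq> \<Lambda> j" if "j < k" for j
    using that unfolding k_def by (rule not_less_Least)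
  have k: "invar k" using invar not_sub by blast
  then have "k \<le> card T" using T_sub by (simp add: invar_def Int_absorb2)
  \<comment> \<open>Once the support is covered, \<open>x\<close> itself competes in the
    least-squares problem, with residual \<open>e\<close>.\<close>
  have "norm (r k) \<le> norm (y - A *v x)"
    using k x_supp T_sub by (simp add: invar_def least_squares_def is_arg_min_linorder)
  then have r_le: "norm (r k) \<le> \<epsilon>" using noise by (simp add: y_eq)
  have supp: "block_supp d l (x - u k) \<subseteq> \<Lambda> k"
    using x_supp T_sub u_supp[OF k] by (intro block_supp_diff) auto
  have "card (\<Lambda> k) \<le> N * K + 1"
    using k \<open>k \<le> card T\<close> T(3) mult_le_mono2[of k K N] unfolding invar_def by linarith
  note block_RIP_bound_lower[OF ripb block_sparseI[OF supp fin[OF k] this]]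
  also have "norm (A *v (x - u k)) \<le> norm (r k) + norm e"
    using norm_triangle_ineq4[of "r k" e] by (simp add: r_eq[OF k])
  finally have w_le: "sqrt (1 - \<delta>) * norm (x - u k) \<le> 2 * \<epsilon>" using r_le noise by linarith
  \<comment> \<open>A block of the support on which \<open>u k\<close> vanished would put the error
    above the bound just obtained.\<close>
  have T_supp: "T \<subseteq> block_supp d l (u k)"
  proof
    fix i assume "i \<in> T"
    then have "block_norm d (u k) i \<noteq> 0" using big(1)[of i "u k"] w_le by linarith
    then show "i \<in> block_supp d l (u k)"
      using \<open>i \<in> T\<close> T(1) block_norm_nonneg[of d "u k" i] by (auto simp: block_supp_def)
  qed
  have N1: "\<Lambda> k = T" if "N = 1"
  proof -
    \<comment> \<open>One index per pass and at most \<open>card T\<close> passes leave no room for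
      a wrong index.\<close>
    have "card (\<Lambda> k) \<le> card T" using k \<open>k \<le> card T\<close> that by (simp add: invar_def)
    then show ?thesis using card_seteq[OF fin[OF k] T_sub] by simp
  qed
  have "block_supp d l (u k) = T" if "\<epsilon> = 0"
  proof -
    have "norm (x - u k) \<le> 0" using w_le \<delta> that by (simp add: mult_le_0_iff)
    then show ?thesis by (simp add: T_def)
  qed
  then have "N = 1 \<or> \<epsilon> = 0 \<longrightarrow> block_supp d l (u k) = T"
    using N1 T_supp u_supp[OF k] by auto
  then show ?thesis
    using \<open>k \<le> card T\<close> r_le T_sub not_sub T_supp u_supp[OF k] N1 k
    unfolding T_def[symmetric] invar_def by blast
qed

end
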